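(* Let the origin demand and destination supply be constant, $\delta(t)=\delta$ and $\sigma(t)=\sigma$. All four point queue models PQM1, PQM2, PQM3, PQM4 have the same stationary states: 1. When $\delta>\sigma$, $\lambda=\Lambda$. That is, the point queue is full. 2. When $\delta<\sigma$, $\lambda=0$. That is, the point queue is empty. 3. When $\delta=\sigma$, $\lambda\in[0,\Lambda]$. That is, the point queue can be stationary at any state.
   Context: A point queue has storage capacity $\Lambda$, origin demand $\delta(t)$, destination supply $\sigma(t)$, and queue size $\lambda(t)$ (between $0$ and $\Lambda$). In a point queue model the queue size evolves by $$\frac{d}{dt}\lambda(t)=\min\{\delta(t),s(t)\}-\min\{d(t),\sigma(t)\},$$ where $d(t)$ and $s(t)$ are the demand and supply of the point queue. Equivalently, $\lambda(t)=F(t)-G(t)$, where the cumulative in- and out-flows $F,G$ satisfy $\frac{d}{dt}F(t)=\min\{\delta(t),s(t)\}$ and $\frac{d}{dt}G(t)=\min\{d(t),\sigma(t)\}$. For $y\ge0$, $H(y)=\lim_{\Delta t\to0^+}\frac{y}{\Delta t}$, i.e. $H(0)=0$ and $H(y)=\infty$ for $y>0$. The four models are given by the following demand and supply functions: - PQM1: $d(t)=\delta(t)+H(\lambda(t))$, $s(t)=\sigma(t)+H(\Lambda-\lambda(t))$; - PQM2: $d(t)=H(\lambda(t))$, $s(t)=H(\Lambda-\lambda(t))$; - PQM3: $d(t)=\delta(t)+H(\lambda(t))$, $s(t)=H(\Lambda-\lambda(t))$; - PQM4: $d(t)=H(\lambda(t))$, $s(t)=\sigma(t)+H(\Lambda-\lambda(t))$.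 Stationary states are the stationary solutions $\lambda(t)=\lambda$ (constant in time) of a point queue model when both the origin demand and the destination supply are constant; in stationary states both $d(t)=d$ and $s(t)=s$ are constant.
   Formalization: Literally false: in PQM2 with 0<δ<σ, λ=0 gives dλ/dt=δ>0. The equalities are proved for Krasovskii stationary solutions; literal ones are shown to lie in the claimed sets, and to attain 0, Λ and interior states wherever true. Λ>0 and δ,σ≥0 are assumed. *)

theory Defs
  imports "HOL-Analysis.Analysis"
begin

text \<open>Value of the limit of \<open>y / h\<close> as \<open>h\<close> decreases to \<open>0\<close>, taken in the extended reals
  because it is infinite for \<open>y > 0\<close>.\<close>

definition pq_H :: "real \<Rightarrow> ereal" where
  "pq_H y = Lim (at_right 0) (\<lambda>h. ereal (y / h))"

lemma pq_H_0: "pq_H 0 = 0"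
  unfolding pq_H_def by (rule tendsto_Lim) (auto simp: zero_ereal_def)

lemma pq_H_pos:
  assumes "y > 0"
  shows "pq_H y = \<infinity>"
  unfolding pq_H_def
proof (rule tendsto_Lim)
  have "filterlim (\<lambda>h. y * inverse h) at_top (at_right 0)"
    by (intro filterlim_tendsto_pos_mult_at_top[OF tendsto_const assms]
        filterlim_inverse_at_top_right)
  then show "((\<lambda>h. ereal (y / h)) \<longlongrightarrow> \<infinity>) (at_right 0)"
    by (simp add: tendsto_PInfty_eq_at_top divide_inverse)
qed simp

datatype pqm = PQM1 | PQM2 | PQM3 | PQM4

text \<open>Throughout, \<open>C\<close> is the storage capacity, \<open>\<delta>\<close> the origin demand, \<open>\<sigma>\<close> the destination supply
  and \<open>q\<close> the queue size.\<close>

fun pq_demand :: "pqm \<Rightarrow> real \<Rightarrow> real \<Rightarrow> ereal" where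
  "pq_demand PQM1 \<delta> q = ereal \<delta> + pq_H q"
| "pq_demand PQM2 \<delta> q = pq_H q"
| "pq_demand PQM3 \<delta> q = ereal \<delta> + pq_H q"
| "pq_demand PQM4 \<delta> q = pq_H q"

fun pq_supply :: "pqm \<Rightarrow> real \<Rightarrow> real \<Rightarrow> real \<Rightarrow> ereal" where
  "pq_supply PQM1 C \<sigma> q = ereal \<sigma> + pq_H (C - q)"
| "pq_supply PQM2 C \<sigma> q = pq_H (C - q)"
| "pq_supply PQM3 C \<sigma> q = pq_H (C - q)"
| "pq_supply PQM4 C \<sigma> q = ereal \<sigma> + pq_H (C - q)"

text \<open>Both minima below are finite, since \<open>\<delta>\<close> and \<open>\<sigma>\<close> are, so that \<^const>\<open>real_of_ereal\<close> loses
  nothing.\<close>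

definition pq_inflow :: "pqm \<Rightarrow> real \<Rightarrow> real \<Rightarrow> real \<Rightarrow> real \<Rightarrow> real" where
  "pq_inflow m C \<delta> \<sigma> q = real_of_ereal (min (ereal \<delta>) (pq_supply m C \<sigma> q))"

definition pq_outflow :: "pqm \<Rightarrow> real \<Rightarrow> real \<Rightarrow> real \<Rightarrow> real" where
  "pq_outflow m \<delta> \<sigma> q = real_of_ereal (min (pq_demand m \<delta> q) (ereal \<sigma>))"

definition pq_rate :: "pqm \<Rightarrow> real \<Rightarrow> real \<Rightarrow> real \<Rightarrow> real \<Rightarrow> real" where
  "pq_rate m C \<delta> \<sigma> q = pq_inflow m C \<delta> \<sigma> q - pq_outflow m \<delta> \<sigma> q"

definition pq_solution ::
  "pqm \<Rightarrow> real \<Rightarrow> (real \<Rightarrow> real) \<Rightarrow> (real \<Rightarrow> real) \<Rightarrow> (real \<Rightarrow> real) \<Rightarrow> bool" where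
  "pq_solution m C \<delta> \<sigma> q \<longleftrightarrow>
     (\<forall>t\<ge>0. 0 \<le> q t \<and> q t \<le> C \<and>
        (q has_real_derivative pq_rate m C (\<delta> t) (\<sigma> t) (q t)) (at t within {0..}))"

definition pq_stationary :: "pqm \<Rightarrow> real \<Rightarrow> real \<Rightarrow> real \<Rightarrow> real \<Rightarrow> bool" where
  "pq_stationary m C \<delta> \<sigma> q \<longleftrightarrow> pq_solution m C (\<lambda>_. \<delta>) (\<lambda>_. \<sigma>) (\<lambda>_. q)"

text \<open>The right-hand side is discontinuous at \<open>q = 0\<close> and \<open>q = C\<close>, and with \<open>H(0) = 0\<close> read
  literally some models have no solution there. For instance, in PQM2 with \<open>0 < \<delta> < \<sigma>\<close> the
  rate is \<open>\<delta> > 0\<close> at the empty queue but \<open>\<delta> - \<sigma> < 0\<close> as soon as the queue is nonempty, so the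
  empty queue is held in place without satisfying the equation. The usual remedy for an ODE with
  discontinuous right-hand side is to replace it by the differential inclusion of Krasovskii, in
  which the rate at \<open>q\<close> may be any number in the closed convex hull of the rates at the admissible
  states arbitrarily close to \<open>q\<close> (with \<open>q\<close> itself included). The functions \<open>H\<close>, \<open>d\<close> and \<open>s\<close>
  are unchanged. The derivative is required at every time rather than at almost every time;
  for constant solutions this makes no difference.\<close>

definition pq_rates :: "pqm \<Rightarrow> real \<Rightarrow> real \<Rightarrow> real \<Rightarrow> real \<Rightarrow> real set" where
  "pq_rates m C \<delta> \<sigma> q =
     (\<Inter>\<epsilon>\<in>{0<..}. closure (convex hull (pq_rate m C \<delta> \<sigma> ` (cball q \<epsilon> \<inter> {0..C}))))"

definition pq_krasovskii_solution ::
  "pqm \<Rightarrow> real \<Rightarrow> (real \<Rightarrow> real) \<Rightarrow> (real \<Rightarrow> real) \<Rightarrow> (real \<Rightarrow> real) \<Rightarrow> bool" where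
  "pq_krasovskii_solution m C \<delta> \<sigma> q \<longleftrightarrow>
     (\<forall>t\<ge>0. 0 \<le> q t \<and> q t \<le> C \<and>
        (\<exists>v\<in>pq_rates m C (\<delta> t) (\<sigma> t) (q t). (q has_real_derivative v) (at t within {0..})))"

definition pq_krasovskii_stationary :: "pqm \<Rightarrow> real \<Rightarrow> real \<Rightarrow> real \<Rightarrow> real \<Rightarrow> bool" where
  "pq_krasovskii_stationary m C \<delta> \<sigma> q \<longleftrightarrow>
     pq_krasovskii_solution m C (\<lambda>_. \<delta>) (\<lambda>_. \<sigma>) (\<lambda>_. q)"

lemma pq_solution_imp_krasovskii:
  assumes "pq_solution m C \<delta> \<sigma> q"
  shows "pq_krasovskii_solution m C \<delta> \<sigma> q"
proof -
  have "pq_rate m C (\<delta> t) (\<sigma> t) (q t) \<in> pq_rates m C (\<delta> t) (\<sigma> t) (q t)" if "t \<ge> 0" for t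
  proof -
    have "q t \<in> {0..C}" using assms that by (auto simp: pq_solution_def)
    then show ?thesis
      unfolding pq_rates_def
      by (intro INT_I subsetD[OF closure_subset] hull_inc imageI) auto
  qed
  then show ?thesis
    using assms unfolding pq_solution_def pq_krasovskii_solution_def by blast
qed

text \<open>The empty queue of PQM2 is not a solution of the literal equation.\<close>

lemma not_pq_stationary_PQM2_empty:
  assumes "C > 0" "\<delta> > 0" "\<sigma> \<ge> 0"
  shows "\<not> pq_stationary PQM2 C \<delta> \<sigma> 0"
proof
  assume "pq_stationary PQM2 C \<delta> \<sigma> 0"
  then have "((\<lambda>_. 0) has_real_derivative pq_rate PQM2 C \<delta> \<sigma> 0) (at 1 within {0..})"
    by (simp add: pq_stationary_def pq_solution_def)
  moreover have "pq_rate PQM2 C \<delta> \<sigma> 0 = \<delta>"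
    using assms by (simp add: pq_rate_def pq_inflow_def pq_outflow_def pq_H_0 pq_H_pos min_def)
  moreover have "at (1::real) within {0..} = at 1"
    by (rule at_within_interior) simp
  ultimately have "((\<lambda>_. 0::real) has_real_derivative \<delta>) (at 1)" by simp
  then show False
    using DERIV_unique[of "\<lambda>_. 0::real" \<delta> 1 0] assms(2) by simp
qed

end

theory Submission
  imports Defs
begin

text \<open>Strictly between empty and full every model has the rate \<open>\<delta> - \<sigma>\<close>, while the
  rate of the empty queue is at least \<open>max 0 (\<delta> - \<sigma>)\<close> and that of the full queue at most
  \<open>min 0 (\<delta> - \<sigma>)\<close>. If \<open>\<sigma> < \<delta>\<close>, the rates near any queue size below the capacity are
  therefore bounded away from \<open>0\<close>, whereas the rates near the capacity include one \<open>\<ge> 0\<close> and one \<open>\<le> 0\<close>, so that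
  their convex hull contains \<open>0\<close>; the case \<open>\<delta> < \<sigma>\<close> is dual.\<close>

lemma pq_rate_interior:
  assumes "0 < q" "q < C"
  shows "pq_rate m C \<delta> \<sigma> q = \<delta> - \<sigma>"
  using assms by (cases m) (simp_all add: pq_rate_def pq_inflow_def pq_outflow_def pq_H_pos)

text \<open>With \<open>0 < C\<close> the supply of an empty queue is infinite, so the inflow is
  \<open>\<delta>\<close>. The demand is \<open>\<delta>\<close> in PQM1 and PQM3, giving outflow
  \<open>min \<delta> \<sigma>\<close>; in PQM2 and PQM4 it is \<open>H(0) = 0\<close>, and
  \<open>0 \<le> \<sigma>\<close> makes the outflow vanish.\<close>

lemma pq_rate_empty:
  assumes "0 < C" "0 \<le> \<sigma>"
  shows "pq_rate m C \<delta> \<sigma> 0 = (if m \<in> {PQM1, PQM3} then \<delta> - min \<delta> \<sigma> else \<delta>)"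
  using assms
  by (cases m) (simp_all add: pq_rate_def pq_inflow_def pq_outflow_def pq_H_pos pq_H_0 min_def)

lemma pq_rate_full:
  assumes "0 < C" "0 \<le> \<delta>"
  shows "pq_rate m C \<delta> \<sigma> C = (if m \<in> {PQM1, PQM4} then min \<delta> \<sigma> - \<sigma> else - \<sigma>)"
  using assms
  by (cases m) (auto simp: pq_rate_def pq_inflow_def pq_outflow_def pq_H_pos pq_H_0 min_def)

lemma pq_rate_ge:
  assumes "0 \<le> q" "q < C" "0 \<le> \<sigma>"
  shows "\<delta> - \<sigma> \<le> pq_rate m C \<delta> \<sigma> q"
  using assms by (cases "q = 0") (auto simp: pq_rate_empty pq_rate_interior)

lemma pq_rate_le:
  assumes "0 < q" "q \<le> C" "0 \<le> \<delta>"
  shows "pq_rate m C \<delta> \<sigma> q \<le> \<delta> - \<sigma>"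
  using assms by (cases "q = C") (auto simp: pq_rate_full pq_rate_interior)

text \<open>Since the filter is one-sided at \<open>t = 0\<close>, uniqueness of two-sided
  derivatives does not cover that time. Passing to the right half-line from \<open>t\<close> treats
  all times alike, because \<open>at_right t\<close> is nontrivial and limits along it are
  unique.\<close>

lemma const_has_real_derivative_within_iff:
  fixes c v :: real
  assumes "t \<ge> 0"
  shows "((\<lambda>_. c) has_real_derivative v) (at t within {0..}) \<longleftrightarrow> v = 0"
proof
  assume "((\<lambda>_. c) has_real_derivative v) (at t within {0..})"
  then have "((\<lambda>_. c) has_real_derivative v) (at t within {t..})"
    by (rule DERIV_subset) (use assms in auto)
  moreover have "at t within {t..} = at_right t"
    by (simp add: at_within_Ici_at_right)
  ultimately have "((\<lambda>_. 0) \<longlongrightarrow> v) (at_right t)"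
    by (simp add: has_field_derivative_iff)
  then show "v = 0"
    using tendsto_unique[of "at_right t" "\<lambda>_. 0::real" v 0] by simp
qed simp

lemma pq_stationary_iff:
  "pq_stationary m C \<delta> \<sigma> q \<longleftrightarrow> q \<in> {0..C} \<and> pq_rate m C \<delta> \<sigma> q = 0"
  unfolding pq_stationary_def pq_solution_def
  by (auto simp: const_has_real_derivative_within_iff)

lemma pq_krasovskii_stationary_iff:
  "pq_krasovskii_stationary m C \<delta> \<sigma> q \<longleftrightarrow> q \<in> {0..C} \<and> 0 \<in> pq_rates m C \<delta> \<sigma> q"
  unfolding pq_krasovskii_stationary_def pq_krasovskii_solution_def
  by (auto simp: const_has_real_derivative_within_iff)

lemma pq_stationary_imp_krasovskii:
  "pq_stationary m C \<delta> \<sigma> q \<Longrightarrow> pq_krasovskii_stationary m C \<delta> \<sigma> q"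
  unfolding pq_stationary_def pq_krasovskii_stationary_def by (rule pq_solution_imp_krasovskii)

text \<open>The intersection over all radii lies in the closed hull for the single radius
  \<open>e\<close>, and a closed convex set containing the rates contains that hull.\<close>

lemma pq_rates_subset:
  assumes "e > 0" "closed S" "convex S"
    and "\<And>x. x \<in> cball q e \<Longrightarrow> x \<in> {0..C} \<Longrightarrow> pq_rate m C \<delta> \<sigma> x \<in> S"
  shows "pq_rates m C \<delta> \<sigma> q \<subseteq> S"
proof -
  have "closure (convex hull (pq_rate m C \<delta> \<sigma> ` (cball q e \<inter> {0..C}))) \<subseteq> S"
    using assms by (intro closure_minimal hull_minimal) auto
  then show ?thesis
    unfolding pq_rates_def using assms(1) by blast
qed

text \<open>For every radius the hull contains the segment from a nonpositive rate to a nonnegative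
  one, hence \<open>0\<close>. The two witnesses may change with the radius.\<close>

lemma zero_in_pq_rates:
  assumes "\<And>e. e > 0 \<Longrightarrow> \<exists>x y. x \<in> cball q e \<inter> {0..C} \<and> y \<in> cball q e \<inter> {0..C} \<and>
    pq_rate m C \<delta> \<sigma> x \<le> 0 \<and> 0 \<le> pq_rate m C \<delta> \<sigma> y"
  shows "0 \<in> pq_rates m C \<delta> \<sigma> q"
  unfolding pq_rates_def
proof (intro INT_I subsetD[OF closure_subset])
  fix e :: real
  assume "e \<in> {0<..}"
  then obtain x y where *: "x \<in> cball q e \<inter> {0..C}" "y \<in> cball q e \<inter> {0..C}"
    and sgn: "pq_rate m C \<delta> \<sigma> x \<le> 0" "0 \<le> pq_rate m C \<delta> \<sigma> y"
    using assms by (metis greaterThan_iff)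
  have "{pq_rate m C \<delta> \<sigma> x .. pq_rate m C \<delta> \<sigma> y}
      = convex hull {pq_rate m C \<delta> \<sigma> x, pq_rate m C \<delta> \<sigma> y}"
    using sgn by (simp add: closed_segment_eq_real_ivl flip: segment_convex_hull)
  also have "\<dots> \<subseteq> convex hull (pq_rate m C \<delta> \<sigma> ` (cball q e \<inter> {0..C}))"
    using * by (intro hull_mono) auto
  finally show "0 \<in> convex hull (pq_rate m C \<delta> \<sigma> ` (cball q e \<inter> {0..C}))"
    using sgn by auto
qed

lemma pq_krasovskii_stationary_imp_full:
  assumes "\<sigma> < \<delta>" "0 \<le> \<sigma>" "pq_krasovskii_stationary m C \<delta> \<sigma> q"
  shows "q = C"
proof (rule ccontr)
  assume "q \<noteq> C"
  with assms(3) have q: "q < C" and 0: "0 \<in> pq_rates m C \<delta> \<sigma> q"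
    by (auto simp: pq_krasovskii_stationary_iff)
  have "pq_rates m C \<delta> \<sigma> q \<subseteq> {\<delta> - \<sigma>..}"
  proof (rule pq_rates_subset)
    \<comment> \<open>Half the distance to \<open>C\<close> keeps the ball away from the full queue,
      the only state where the lower bound \<open>\<delta> - \<sigma>\<close> can fail.\<close>
    fix x assume "x \<in> cball q ((C - q) / 2)" "x \<in> {0..C}"
    then have "0 \<le> x" "x < C"
      using q by (auto simp: dist_real_def abs_if split: if_splits)
    then show "pq_rate m C \<delta> \<sigma> x \<in> {\<delta> - \<sigma>..}"
      using pq_rate_ge assms(2) by simp
  qed (use q in auto)
  with 0 assms(1) show False by auto
qed

lemma pq_krasovskii_stationary_imp_empty:
  assumes "\<delta> < \<sigma>" "0 \<le> \<delta>" "pq_krasovskii_stationary m C \<delta> \<sigma> q"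
  shows "q = 0"
proof (rule ccontr)
  assume "q \<noteq> 0"
  with assms(3) have q: "0 < q" and 0: "0 \<in> pq_rates m C \<delta> \<sigma> q"
    by (auto simp: pq_krasovskii_stationary_iff)
  have "pq_rates m C \<delta> \<sigma> q \<subseteq> {..\<delta> - \<sigma>}"
  proof (rule pq_rates_subset)
    fix x assume "x \<in> cball q (q / 2)" "x \<in> {0..C}"
    then have "0 < x" "x \<le> C"
      using q by (auto simp: dist_real_def abs_if split: if_splits)
    then show "pq_rate m C \<delta> \<sigma> x \<in> {..\<delta> - \<sigma>}"
      using pq_rate_le assms(2) by simp
  qed (use q in auto)
  with 0 assms(1) show False by auto
qed

lemma pq_krasovskii_stationary_empty:
  assumes "0 < C" "0 \<le> \<delta>" "\<delta> \<le> \<sigma>"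
  shows "pq_krasovskii_stationary m C \<delta> \<sigma> 0"
proof -
  have "0 \<in> pq_rates m C \<delta> \<sigma> 0"
  proof (rule zero_in_pq_rates)
    fix e :: real assume "e > 0"
    \<comment> \<open>A nonempty, nonfull state within \<open>e\<close> of \<open>0\<close> supplies
      the rate \<open>\<delta> - \<sigma> \<le> 0\<close>; the empty queue itself supplies the
      nonnegative rate.\<close>
    define x where "x = min e (C / 2)"
    have x: "0 < x" "x < C" "x \<le> e"
      using \<open>e > 0\<close> assms(1) by (auto simp: x_def)
    moreover have "pq_rate m C \<delta> \<sigma> x \<le> 0" "0 \<le> pq_rate m C \<delta> \<sigma> 0"
      using x assms by (auto simp: pq_rate_interior pq_rate_empty)
    ultimately show "\<exists>x y. x \<in> cball 0 e \<inter> {0..C} \<and> y \<in> cball 0 e \<inter> {0..C} \<and>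
        pq_rate m C \<delta> \<sigma> x \<le> 0 \<and> 0 \<le> pq_rate m C \<delta> \<sigma> y"
      using \<open>e > 0\<close> by (intro exI[of _ x] exI[of _ 0]) auto
  qed
  with assms(1) show ?thesis by (simp add: pq_krasovskii_stationary_iff)
qed

lemma pq_krasovskii_stationary_full:
  assumes "0 < C" "0 \<le> \<sigma>" "\<sigma> \<le> \<delta>"
  shows "pq_krasovskii_stationary m C \<delta> \<sigma> C"
proof -
  have "0 \<in> pq_rates m C \<delta> \<sigma> C"
  proof (rule zero_in_pq_rates)
    fix e :: real assume "e > 0"
    \<comment> \<open>The bound \<open>C / 2\<close> keeps \<open>y\<close> positive even for large
      \<open>e\<close>, so that the interior rate applies.\<close>
    define y where "y = max (C - e) (C / 2)"
    have y: "0 < y" "y < C" "C - y \<le> e"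
      using \<open>e > 0\<close> assms(1) by (auto simp: y_def)
    moreover have "pq_rate m C \<delta> \<sigma> C \<le> 0" "0 \<le> pq_rate m C \<delta> \<sigma> y"
      using y assms by (auto simp: pq_rate_interior pq_rate_full)
    ultimately show "\<exists>x y. x \<in> cball C e \<inter> {0..C} \<and> y \<in> cball C e \<inter> {0..C} \<and>
        pq_rate m C \<delta> \<sigma> x \<le> 0 \<and> 0 \<le> pq_rate m C \<delta> \<sigma> y"
      using \<open>e > 0\<close> by (intro exI[of _ C] exI[of _ y]) (auto simp: dist_real_def)
  qed
  with assms(1) show ?thesis by (simp add: pq_krasovskii_stationary_iff)
qed

lemma pq_stationary_interior:
  assumes "0 < q" "q < C"
  shows "pq_stationary m C \<sigma> \<sigma> q"
  using assms by (simp add: pq_stationary_iff pq_rate_interior)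

lemma pq_krasovskii_stationary_balanced_iff:
  assumes "0 < C" "0 \<le> \<sigma>"
  shows "pq_krasovskii_stationary m C \<sigma> \<sigma> q \<longleftrightarrow> q \<in> {0..C}"
proof
  assume "q \<in> {0..C}"
  \<comment> \<open>Interior states solve the literal equation; at the endpoints it may fail, and
    the hull condition is used instead.\<close>
  then consider "q = 0" | "q = C" | "0 < q" "q < C" by fastforce
  then show "pq_krasovskii_stationary m C \<sigma> \<sigma> q"
    using assms
    by cases (simp_all add: pq_krasovskii_stationary_empty pq_krasovskii_stationary_full
      pq_stationary_imp_krasovskii pq_stationary_interior)
qed (simp add: pq_krasovskii_stationary_iff)

text \<open>The first three conjuncts classify the stationary states of the inclusion. The others
  record what survives for the literal equation: its stationary states are among these, and an
  endpoint is attained when its rate vanishes, as when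
  \<open>\<delta> - min \<delta> \<sigma> = 0\<close> for the empty queue of PQM1 and PQM3.\<close>

theorem theorem5p5:
  fixes C \<delta> \<sigma> :: real
  assumes "0 < C" and "0 \<le> \<delta>" and "0 \<le> \<sigma>"
  shows "\<forall>m.
      (\<sigma> < \<delta> \<longrightarrow> {q. pq_krasovskii_stationary m C \<delta> \<sigma> q} = {C}) \<and>
      (\<delta> < \<sigma> \<longrightarrow> {q. pq_krasovskii_stationary m C \<delta> \<sigma> q} = {0}) \<and>
      (\<delta> = \<sigma> \<longrightarrow> {q. pq_krasovskii_stationary m C \<delta> \<sigma> q} = {0..C}) \<and>
      (\<sigma> < \<delta> \<longrightarrow> {q. pq_stationary m C \<delta> \<sigma> q} \<subseteq> {C}) \<and>
      (\<delta> < \<sigma> \<longrightarrow> {q. pq_stationary m C \<delta> \<sigma> q} \<subseteq> {0}) \<and>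
      (\<delta> = \<sigma> \<longrightarrow> {0<..<C} \<subseteq> {q. pq_stationary m C \<delta> \<sigma> q} \<and>
                {q. pq_stationary m C \<delta> \<sigma> q} \<subseteq> {0..C}) \<and>
      (\<delta> \<le> \<sigma> \<and> (m \<in> {PQM1, PQM3} \<or> \<delta> = 0) \<longrightarrow> pq_stationary m C \<delta> \<sigma> 0) \<and>
      (\<sigma> \<le> \<delta> \<and> (m \<in> {PQM1, PQM4} \<or> \<sigma> = 0) \<longrightarrow> pq_stationary m C \<delta> \<sigma> C)"
proof (intro allI conjI impI)
  fix m
  show "{q. pq_krasovskii_stationary m C \<delta> \<sigma> q} = {C}" if "\<sigma> < \<delta>"
    using that assms pq_krasovskii_stationary_imp_full pq_krasovskii_stationary_full by fastforce
  then show "{q. pq_stationary m C \<delta> \<sigma> q} \<subseteq> {C}" if "\<sigma> < \<delta>"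
    using that pq_stationary_imp_krasovskii by blast
  show "{q. pq_krasovskii_stationary m C \<delta> \<sigma> q} = {0}" if "\<delta> < \<sigma>"
    using that assms pq_krasovskii_stationary_imp_empty pq_krasovskii_stationary_empty by fastforce
  then show "{q. pq_stationary m C \<delta> \<sigma> q} \<subseteq> {0}" if "\<delta> < \<sigma>"
    using that pq_stationary_imp_krasovskii by blast
  show "{q. pq_krasovskii_stationary m C \<delta> \<sigma> q} = {0..C}" if "\<delta> = \<sigma>"
    using that assms by (auto simp: pq_krasovskii_stationary_balanced_iff)
  show "{0<..<C} \<subseteq> {q. pq_stationary m C \<delta> \<sigma> q}" if "\<delta> = \<sigma>"
    using that by (auto simp: pq_stationary_interior)
  show "{q. pq_stationary m C \<delta> \<sigma> q} \<subseteq> {0..C}"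
    by (auto simp: pq_stationary_iff)
  show "pq_stationary m C \<delta> \<sigma> 0" if "\<delta> \<le> \<sigma> \<and> (m \<in> {PQM1, PQM3} \<or> \<delta> = 0)"
    using that assms by (auto simp: pq_stationary_iff pq_rate_empty)
  show "pq_stationary m C \<delta> \<sigma> C" if "\<sigma> \<le> \<delta> \<and> (m \<in> {PQM1, PQM4} \<or> \<sigma> = 0)"
    using that assms by (auto simp: pq_stationary_iff pq_rate_full)
qed

end
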